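(* Let $(W,S)$ be an affine Coxeter group and let $w\in W$. Then the annex $\mathrm{Annex}(w)=\{y\in W : w\not\leq y\}$ is a finite set.
   Context: A Coxeter system $(W,S)$ has presentation $\langle s_i, i\in I \mid (s_is_j)^{m_{ij}}=1\rangle$ with $m_{ii}=1$ and $m_{ij}\in\mathbb{Z}_{\ge 2}\cup\{\infty\}$ for $i\neq j$. An affine Coxeter group is an infinite Coxeter group having a normal abelian subgroup of finite index (equivalently, an affine Weyl group of a crystallographic root system). $\leq$ denotes the Bruhat order: $x\le y$ iff some (equivalently every) reduced expression of $y$ contains a subword that is a reduced expression of $x$. The annex of $w$ is $\mathrm{Annex}(w)=\{y\in W: w\not\le y\}$, the complement of the upper Bruhat interval $[w,\infty)$.
   Formalization: The formal theorem assumes that S is finite and that (W,S) is irreducible (connected Coxeter graph); without this the claim fails, e.g. in a product of two infinite dihedral groups with w=(s,e) the annex contains every (e,y) and is infinite. *)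

theory Defs
  imports "HOL-Algebra.Coset" "HOL-Library.Extended_Nat" "HOL-Library.Sublist"
begin

(* Coxeter matrix on a (finite) index set I: m i i = 1, symmetric, m i j \<in> {2,3,...} \<union> {\<infinity>} for i \<noteq> j *)
definition coxeter_matrix :: "'i set \<Rightarrow> ('i \<Rightarrow> 'i \<Rightarrow> enat) \<Rightarrow> bool" where
  "coxeter_matrix I m \<longleftrightarrow>
     (\<forall>i\<in>I. m i i = 1) \<and> (\<forall>i\<in>I. \<forall>j\<in>I. m i j = m j i) \<and>
     (\<forall>i\<in>I. \<forall>j\<in>I. i \<noteq> j \<longrightarrow> m i j \<ge> 2)"

(* alternating word i j i j ... of length n *)
definition alt_word :: "'i \<Rightarrow> 'i \<Rightarrow> nat \<Rightarrow> 'i list" where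
  "alt_word i j n = map (\<lambda>k. if even k then i else j) [0..<n]"

(* word equivalence in the presented group < s_i | (s_i s_j)^(m_ij) = 1 >:
   the congruence on words over I generated by (s_i s_j)^(m_ij) = 1 (finite m_ij).
   Since m_ii = 1 the generators are involutions, so this monoid presentation
   presents the same group. *)
inductive cox_eq :: "'i set \<Rightarrow> ('i \<Rightarrow> 'i \<Rightarrow> enat) \<Rightarrow> 'i list \<Rightarrow> 'i list \<Rightarrow> bool"
  for I m where
  refl: "set xs \<subseteq> I \<Longrightarrow> cox_eq I m xs xs"
| sym: "cox_eq I m xs ys \<Longrightarrow> cox_eq I m ys xs"
| trans: "cox_eq I m xs ys \<Longrightarrow> cox_eq I m ys zs \<Longrightarrow> cox_eq I m xs zs"
| rel: "set xs \<subseteq> I \<Longrightarrow> set ys \<subseteq> I \<Longrightarrow> i \<in> I \<Longrightarrow> j \<in> I \<Longrightarrow> m i j = enat k \<Longrightarrow>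
        cox_eq I m (xs @ alt_word i j (2 * k) @ ys) (xs @ ys)"

(* group elements = equivalence classes of words *)
definition cox_cls :: "'i set \<Rightarrow> ('i \<Rightarrow> 'i \<Rightarrow> enat) \<Rightarrow> 'i list \<Rightarrow> 'i list set" where
  "cox_cls I m xs = {ys. cox_eq I m xs ys}"

definition cox_mult :: "'i set \<Rightarrow> ('i \<Rightarrow> 'i \<Rightarrow> enat) \<Rightarrow> 'i list set \<Rightarrow> 'i list set \<Rightarrow> 'i list set" where
  "cox_mult I m X Y = cox_cls I m ((SOME x. x \<in> X) @ (SOME y. y \<in> Y))"

(* the Coxeter group W as a HOL-Algebra monoid structure *)
definition coxW :: "'i set \<Rightarrow> ('i \<Rightarrow> 'i \<Rightarrow> enat) \<Rightarrow> 'i list set monoid" where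
  "coxW I m = \<lparr> carrier = {xs. set xs \<subseteq> I} // {(x, y). cox_eq I m x y},
               mult = cox_mult I m,
               one = cox_cls I m [] \<rparr>"

(* reduced expression: word of minimal length in its class *)
definition cox_reduced :: "'i set \<Rightarrow> ('i \<Rightarrow> 'i \<Rightarrow> enat) \<Rightarrow> 'i list \<Rightarrow> bool" where
  "cox_reduced I m xs \<longleftrightarrow> set xs \<subseteq> I \<and> (\<forall>ys. cox_eq I m xs ys \<longrightarrow> length xs \<le> length ys)"

(* Bruhat order: x \<le> y iff some reduced expression of y contains a subword
   that is a reduced expression of x *)
definition bruhat_le :: "'i set \<Rightarrow> ('i \<Rightarrow> 'i \<Rightarrow> enat) \<Rightarrow> 'i list set \<Rightarrow> 'i list set \<Rightarrow> bool" where
  "bruhat_le I m X Y \<longleftrightarrow>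
     (\<exists>v\<in>Y. cox_reduced I m v \<and> (\<exists>u\<in>X. cox_reduced I m u \<and> subseq u v))"

definition annex :: "'i set \<Rightarrow> ('i \<Rightarrow> 'i \<Rightarrow> enat) \<Rightarrow> 'i list set \<Rightarrow> 'i list set set" where
  "annex I m w = {y \<in> carrier (coxW I m). \<not> bruhat_le I m w y}"

(* affine: infinite, with a normal abelian subgroup of finite index *)
definition affine_coxeter :: "'i set \<Rightarrow> ('i \<Rightarrow> 'i \<Rightarrow> enat) \<Rightarrow> bool" where
  "affine_coxeter I m \<longleftrightarrow>
     infinite (carrier (coxW I m)) \<and>
     (\<exists>N. N \<lhd> coxW I m \<and> comm_group ((coxW I m)\<lparr>carrier := N\<rparr>) \<and>
          finite (rcosets\<^bsub>coxW I m\<^esub> N))"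

(* irreducible: the Coxeter graph (edges where m_ij \<noteq> 2) is connected *)
definition cox_irreducible :: "'i set \<Rightarrow> ('i \<Rightarrow> 'i \<Rightarrow> enat) \<Rightarrow> bool" where
  "cox_irreducible I m \<longleftrightarrow>
     (\<forall>i\<in>I. \<forall>j\<in>I. (i, j) \<in> {(a, b). a \<in> I \<and> b \<in> I \<and> a \<noteq> b \<and> m a b \<noteq> 2}\<^sup>*)"

end

theory Submission
  imports Defs Complex_Main
begin

text \<open>
  If every proper parabolic subgroup of \<open>W\<close> is finite, there is a bound \<open>M\<close> such that every reduced
  word of length \<open>M\<close> contains all generators; hence a reduced word of length at least \<open>M * length u\<close>
  contains \<open>u\<close> as a subword, and only finitely many elements can fail to lie above the class of \<open>u\<close>.

  Proper parabolic subgroups are finite by a cocycle argument. Suppose \<open>H = W\<^sub>J\<close> is infinite with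
  \<open>J \<noteq> I\<close> minimal. By irreducibility some generator \<open>s \<notin> H\<close> does not commute with \<open>J\<close>, and the
  centralizer of \<open>s\<close> in \<open>H\<close> is contained in a smaller parabolic subgroup, so it is finite. Let \<open>N\<close>
  be the abelian normal subgroup of finite index. Comparing, for \<open>a, x \<in> N \<inter> H\<close>, the reflections inverted
  by the two products of the commuting elements \<open>s a s\<close> and \<open>x\<close> shows that \<open>N \<inter> H\<close> lies in two cosets of that
  centralizer, so that \<open>N \<inter> H\<close>, and with it \<open>H\<close>, is finite.
\<close>

section \<open>The presented group and its parabolic subgroups\<close>

lemma alt_word_Suc: "alt_word i j (Suc n) = i # alt_word j i n"
proof -
  have "[0..<Suc n] = 0 # map Suc [0..<n]"
    by (simp add: upt_conv_Cons map_Suc_upt)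
  thus ?thesis by (simp add: alt_word_def del: upt_Suc)
qed

lemma alt_word_Suc_right: "alt_word i j (Suc n) = alt_word i j n @ [if even n then i else j]"
  by (simp add: alt_word_def)

lemma alt_word_add_even: "alt_word i j (2 * k + n) = alt_word i j (2 * k) @ alt_word i j n"
  by (induction k) (simp_all add: alt_word_Suc, simp add: alt_word_def)

locale coxeter_presentation =
  fixes I :: "'i set" and m :: "'i \<Rightarrow> 'i \<Rightarrow> enat"
  assumes coxeter_matrix: "coxeter_matrix I m"
begin

abbreviation W :: "'i list set monoid" where "W \<equiv> coxW I m"

abbreviation cls :: "'i list \<Rightarrow> 'i list set" where "cls \<equiv> cox_cls I m"

lemma cox_eq_words: "cox_eq I m xs ys \<Longrightarrow> set xs \<subseteq> I \<and> set ys \<subseteq> I"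
proof (induction rule: cox_eq.induct)
  case (rel xs ys i j k)
  then show ?case by (auto simp: alt_word_def)
qed auto

lemma cox_eq_context:
  assumes "cox_eq I m xs ys" "set us \<subseteq> I" "set vs \<subseteq> I"
  shows "cox_eq I m (us @ xs @ vs) (us @ ys @ vs)"
  using assms
proof (induction rule: cox_eq.induct)
  case (rel xs ys i j k)
  then show ?case
    using cox_eq.rel[of "us @ xs" I "ys @ vs" i j m k] by simp
next
  case (trans xs ys zs)
  then show ?case by (blast intro: cox_eq.trans)
next
  case (refl xs)
  then show ?case by (intro cox_eq.refl) auto
qed (auto intro: cox_eq.sym)

lemma cls_eq_iff: "set xs \<subseteq> I \<Longrightarrow> cls xs = cls ys \<longleftrightarrow> cox_eq I m xs ys"
  unfolding cox_cls_def by (blast intro: cox_eq.refl cox_eq.sym cox_eq.trans)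

lemma carrier_W: "carrier W = cls ` {xs. set xs \<subseteq> I}"
  by (auto simp: coxW_def quotient_def cox_cls_def)

lemma cls_carrier [simp]: "set xs \<subseteq> I \<Longrightarrow> cls xs \<in> carrier W"
  by (auto simp: carrier_W)

lemma cls_eq_of_mem: "xs \<in> cls ys \<Longrightarrow> cls xs = cls ys \<and> set xs \<subseteq> I"
  unfolding cox_cls_def by (auto intro: cox_eq.sym cox_eq.trans dest: cox_eq_words)

text \<open>\<open>cox_mult\<close> multiplies representatives picked by \<open>SOME\<close>. Since
  \<open>cox_eq\<close> is a congruence in each factor, the choice does not matter.\<close>

lemma cls_mult:
  assumes "set xs \<subseteq> I" "set ys \<subseteq> I"
  shows "cls xs \<otimes>\<^bsub>W\<^esub> cls ys = cls (xs @ ys)"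
proof -
  define u v where "u = (SOME u. u \<in> cls xs)" and "v = (SOME v. v \<in> cls ys)"
  have "xs \<in> cls xs" "ys \<in> cls ys"
    using assms by (auto simp: cox_cls_def intro: cox_eq.refl)
  hence "u \<in> cls xs" "v \<in> cls ys"
    unfolding u_def v_def by (metis someI)+
  hence *: "cox_eq I m xs u" "cox_eq I m ys v"
    by (auto simp: cox_cls_def)
  have "cox_eq I m (xs @ ys) (u @ v)"
    using cox_eq_context[OF *(1), of "[]" ys] cox_eq_context[OF *(2), of u "[]"]
      cox_eq_words[OF *(1)] assms by (auto intro: cox_eq.trans)
  thus ?thesis
    using assms by (simp add: coxW_def cox_mult_def u_def v_def flip: cls_eq_iff)
qed

lemma one_W: "\<one>\<^bsub>W\<^esub> = cls []"
  by (simp add: coxW_def)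

lemma cls_relator:
  assumes "i \<in> I" "j \<in> I" "m i j = enat k"
  shows "cls (alt_word i j (2 * k)) = cls []"
  using cox_eq.rel[of "[]" I "[]" i j m k] assms
  by (subst cls_eq_iff) (auto simp: alt_word_def)

lemma cls_square: "i \<in> I \<Longrightarrow> cls [i, i] = cls []"
  using cls_relator[of i i 1] coxeter_matrix
  by (simp add: coxeter_matrix_def alt_word_def one_enat_def numeral_2_eq_2)

text \<open>Generators are involutions, so the word cancels from the middle outwards. This supplies
  inverses: the monoid presentation defines a group.\<close>

lemma cls_append_rev: "set xs \<subseteq> I \<Longrightarrow> cls (xs @ rev xs) = cls []"
proof (induction xs)
  case (Cons x xs)
  have "cls (x # xs @ rev xs @ [x]) = cls [x] \<otimes>\<^bsub>W\<^esub> (cls (xs @ rev xs) \<otimes>\<^bsub>W\<^esub> cls [x])"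
    using Cons.prems by (simp add: cls_mult)
  also have "\<dots> = cls []"
    using Cons by (simp add: cls_mult cls_square)
  finally show ?case by simp
qed simp

sublocale W: group W
proof (rule groupI)
  show "x \<otimes>\<^bsub>W\<^esub> y \<in> carrier W" if "x \<in> carrier W" "y \<in> carrier W" for x y
    using that by (auto simp: carrier_W cls_mult)
  show "x \<otimes>\<^bsub>W\<^esub> y \<otimes>\<^bsub>W\<^esub> z = x \<otimes>\<^bsub>W\<^esub> (y \<otimes>\<^bsub>W\<^esub> z)"
    if "x \<in> carrier W" "y \<in> carrier W" "z \<in> carrier W" for x y z
    using that by (auto simp: carrier_W cls_mult)
  show "\<exists>y\<in>carrier W. y \<otimes>\<^bsub>W\<^esub> x = \<one>\<^bsub>W\<^esub>" if x: "x \<in> carrier W" for x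
  proof -
    obtain xs where xs: "set xs \<subseteq> I" "x = cls xs"
      using x by (auto simp: carrier_W)
    show ?thesis
      using xs cls_append_rev[of "rev xs"]
      by (intro bexI[of _ "cls (rev xs)"]) (auto simp: cls_mult one_W)
  qed
qed (auto simp: carrier_W one_W cls_mult)

lemma inv_cls: "set xs \<subseteq> I \<Longrightarrow> inv\<^bsub>W\<^esub> (cls xs) = cls (rev xs)"
  using cls_append_rev[of "rev xs"]
  by (intro W.inv_equality) (auto simp: cls_mult one_W)

definition parabolic :: "'i set \<Rightarrow> 'i list set set" where
  "parabolic J = cls ` {xs. set xs \<subseteq> J}"

lemma subgroup_parabolic:
  assumes "J \<subseteq> I"
  shows "subgroup (parabolic J) W"
proof (rule W.subgroupI)
  show "parabolic J \<subseteq> carrier W"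
    using assms by (auto simp: parabolic_def)
  show "parabolic J \<noteq> {}"
    by (auto simp: parabolic_def intro: exI[of _ "[]"])
  show "inv\<^bsub>W\<^esub> a \<in> parabolic J" if "a \<in> parabolic J" for a
    using that assms inv_cls by (force simp: parabolic_def)
  show "a \<otimes>\<^bsub>W\<^esub> b \<in> parabolic J" if ab: "a \<in> parabolic J" "b \<in> parabolic J" for a b
  proof -
    obtain xs ys where "a = cls xs" "b = cls ys" "set xs \<subseteq> J" "set ys \<subseteq> J"
      using ab by (auto simp: parabolic_def)
    thus ?thesis
      using assms cls_mult[of xs ys] by (auto simp: parabolic_def)
  qed
qed

end

section \<open>Reflections inverted by an element\<close>

context coxeter_presentation
begin

abbreviation conj :: "'i list set \<Rightarrow> 'i list set \<Rightarrow> 'i list set" where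
  "conj g r \<equiv> g \<otimes>\<^bsub>W\<^esub> r \<otimes>\<^bsub>W\<^esub> inv\<^bsub>W\<^esub> g"

text \<open>
  For \<open>xs = [x\<^sub>1, \<dots>, x\<^sub>n]\<close> the entries are \<open>x\<^sub>1 \<dots> x\<^sub>k x\<^sub>k\<^sub>-\<^sub>1 \<dots> x\<^sub>1\<close>. Only the parity of the
  multiplicity of a reflection depends on the class of \<open>xs\<close> alone.
\<close>

fun refls :: "'i list \<Rightarrow> 'i list set list" where
  "refls [] = []"
| "refls (x # xs) = cls [x] # map (conj (cls [x])) (refls xs)"

lemma refls_subgroup:
  assumes "subgroup H W" "\<And>x. x \<in> set xs \<Longrightarrow> cls [x] \<in> H"
  shows "set (refls xs) \<subseteq> H"
  using assms(2)
proof (induction xs)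
  case (Cons x xs)
  then show ?case
    by (auto intro!: subgroup.m_closed[OF assms(1)] subgroup.m_inv_closed[OF assms(1)])
qed simp

lemma refls_carrier: "set xs \<subseteq> I \<Longrightarrow> set (refls xs) \<subseteq> carrier W"
  by (rule refls_subgroup[OF W.subgroup_self]) auto

lemma conj_mult:
  assumes "g \<in> carrier W" "h \<in> carrier W" "r \<in> carrier W"
  shows "conj (g \<otimes>\<^bsub>W\<^esub> h) r = conj g (conj h r)"
  using assms by (simp add: W.m_assoc W.inv_mult_group)

lemma refls_append:
  assumes "set xs \<subseteq> I" "set ys \<subseteq> I"
  shows "refls (xs @ ys) = refls xs @ map (conj (cls xs)) (refls ys)"
  using assms(1)
proof (induction xs)
  case Nil
  then show ?case
    using refls_carrier[OF assms(2)] by (auto simp flip: one_W intro!: map_idI[symmetric])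
next
  case (Cons x xs)
  have "cls (x # xs) = cls [x] \<otimes>\<^bsub>W\<^esub> cls xs"
    using Cons.prems by (simp add: cls_mult)
  thus ?case
    using Cons refls_carrier[OF assms(2)] by (auto simp: conj_mult)
qed

lemma count_list_map_conj:
  assumes "g \<in> carrier W" "r \<in> carrier W" "set L \<subseteq> carrier W"
  shows "count_list (map (conj g) L) r = count_list L (conj (inv\<^bsub>W\<^esub> g) r)"
  using assms(3)
proof (induction L)
  case (Cons a L)
  have "conj g a = r \<longleftrightarrow> a = conj (inv\<^bsub>W\<^esub> g) r"
    using assms Cons.prems conj_mult[of "inv\<^bsub>W\<^esub> g" g a] conj_mult[of g "inv\<^bsub>W\<^esub> g" r] by auto
  thus ?case using Cons by auto
qed simp

lemma set_alt_word: "i \<in> I \<Longrightarrow> j \<in> I \<Longrightarrow> set (alt_word i j n) \<subseteq> I"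
  by (auto simp: alt_word_def)

text \<open>Conjugating by the first letter lengthens an odd alternating palindrome by one letter at
  each end, so the list runs through the reflections of the dihedral subgroup of \<open>i\<close>
  and \<open>j\<close>.\<close>

lemma refls_alt_word:
  assumes "i \<in> I" "j \<in> I"
  shows "refls (alt_word i j n) = map (\<lambda>q. cls (alt_word i j (2 * q + 1))) [0..<n]"
  using assms
proof (induction n arbitrary: i j)
  case 0
  then show ?case by (simp add: alt_word_def)
next
  case (Suc n)
  have step: "conj (cls [i]) (cls (alt_word j i (2 * q + 1))) = cls (alt_word i j (2 * Suc q + 1))" for q
  proof -
    have "alt_word i j (2 * Suc q + 1) = i # alt_word j i (2 * q + 1) @ [i]"
      using alt_word_Suc[of i j "Suc (2 * q + 1)"] alt_word_Suc_right[of j i "2 * q + 1"] by simp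
    thus ?thesis
      using Suc.prems set_alt_word[of j i "2 * q + 1"] by (simp add: inv_cls cls_mult)
  qed
  have "[0..<Suc n] = 0 # map Suc [0..<n]"
    by (simp add: upt_conv_Cons map_Suc_upt)
  moreover have "alt_word i j (2 * 0 + 1) = [i]"
    by (simp add: alt_word_def)
  ultimately show ?case
    using Suc.IH[of j i] Suc.prems step
    by (simp add: alt_word_Suc[of i j n] o_def del: upt_Suc)
qed

text \<open>Entries \<open>q\<close> and \<open>q + k\<close> differ by the left factor
  \<open>(s_i s_j)^k = 1\<close>, so the list of length \<open>2 * k\<close> is one block of length
  \<open>k\<close> written twice.\<close>

lemma even_count_refls_relator:
  assumes "i \<in> I" "j \<in> I" "m i j = enat k"
  shows "even (count_list (refls (alt_word i j (2 * k))) r)"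
proof -
  let ?f = "\<lambda>q. cls (alt_word i j (2 * q + 1))"
  have "?f (q + k) = ?f q" for q
  proof -
    have "?f (q + k) = cls (alt_word i j (2 * k)) \<otimes>\<^bsub>W\<^esub> ?f q"
      using assms alt_word_add_even[of i j k "2 * q + 1"]
      by (simp add: cls_mult set_alt_word algebra_simps)
    thus ?thesis
      using assms by (simp add: cls_relator set_alt_word flip: one_W)
  qed
  hence "map ?f [k..<k + k] = map ?f [0..<k]"
    by (intro nth_equalityI) (auto simp: add.commute)
  moreover have "[0..<2 * k] = [0..<k] @ [k..<k + k]"
    using upt_add_eq_append[of 0 k k] by (simp add: mult_2)
  ultimately have "refls (alt_word i j (2 * k)) = map ?f [0..<k] @ map ?f [0..<k]"
    using refls_alt_word[OF assms(1,2), of "2 * k"] by simp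
  thus ?thesis by simp
qed

text \<open>An inserted relator has trivial class, so the entries coming from the suffix are
  unchanged; its own entries occur with even multiplicity, also after conjugation by the
  prefix.\<close>

lemma odd_count_refls_cong:
  assumes "cox_eq I m xs ys" "r \<in> carrier W"
  shows "odd (count_list (refls xs) r) \<longleftrightarrow> odd (count_list (refls ys) r)"
  using assms
proof (induction rule: cox_eq.induct)
  case (rel xs ys i j k)
  let ?z = "alt_word i j (2 * k)"
  have z: "set ?z \<subseteq> I" "cls ?z = \<one>\<^bsub>W\<^esub>"
    using rel by (simp_all add: set_alt_word cls_relator one_W)
  have "map (conj (cls ?z)) (refls ys) = refls ys"
    using refls_carrier[OF rel(2)] z(2) by (auto intro!: map_idI)
  hence "refls (xs @ ?z @ ys) = refls xs @ map (conj (cls xs)) (refls ?z) @ map (conj (cls xs)) (refls ys)"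
    using rel z by (simp add: refls_append)
  moreover have "count_list (map (conj (cls xs)) (refls ?z)) r
      = count_list (refls ?z) (conj (inv\<^bsub>W\<^esub> (cls xs)) r)"
    using rel z by (intro count_list_map_conj refls_carrier) auto
  ultimately show ?case
    using rel even_count_refls_relator[OF rel(3-5)] by (simp add: refls_append)
qed auto

text \<open>The left inversion set of \<open>g\<close>: for a reflection \<open>r\<close> it is the
  classical condition that \<open>r g\<close> is shorter than \<open>g\<close>. Parity instead of
  membership in \<open>refls\<close> makes it independent of the word.\<close>

definition inverts :: "'i list set \<Rightarrow> 'i list set \<Rightarrow> bool" where
  "inverts g r \<longleftrightarrow> (\<exists>xs. set xs \<subseteq> I \<and> g = cls xs \<and> odd (count_list (refls xs) r))"

lemma inverts_cls:
  assumes "set xs \<subseteq> I" "r \<in> carrier W"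
  shows "inverts (cls xs) r \<longleftrightarrow> odd (count_list (refls xs) r)"
  using assms odd_count_refls_cong cls_eq_iff unfolding inverts_def by metis

text \<open>The cocycle identity: by \<open>refls_append\<close> the multiplicities add, and the
  second summand is shifted by conjugation with \<open>g\<close>.\<close>

lemma inverts_mult:
  assumes "g \<in> carrier W" "h \<in> carrier W" "r \<in> carrier W"
  shows "inverts (g \<otimes>\<^bsub>W\<^esub> h) r \<longleftrightarrow> inverts g r \<noteq> inverts h (conj (inv\<^bsub>W\<^esub> g) r)"
proof -
  obtain xs ys where xy: "set xs \<subseteq> I" "g = cls xs" "set ys \<subseteq> I" "h = cls ys"
    using assms by (auto simp: carrier_W)
  show ?thesis
    using xy assms refls_carrier[OF xy(3)]
    by (simp add: cls_mult inverts_cls refls_append count_list_map_conj)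
qed

lemma inverts_generator: "i \<in> I \<Longrightarrow> r \<in> carrier W \<Longrightarrow> inverts (cls [i]) r \<longleftrightarrow> r = cls [i]"
  by (auto simp: inverts_cls)

lemma finite_inverts: "g \<in> carrier W \<Longrightarrow> finite {r \<in> carrier W. inverts g r}"
proof -
  assume "g \<in> carrier W"
  then obtain xs where xs: "set xs \<subseteq> I" "g = cls xs"
    by (auto simp: carrier_W)
  have "{r \<in> carrier W. inverts g r} \<subseteq> set (refls xs)"
    using xs by (auto simp: inverts_cls) (metis count_notin even_zero)
  thus ?thesis by (rule finite_subset) simp
qed

text \<open>Compute the inversions from a word over \<open>J\<close>: every entry of its list is a
  product of letters in \<open>J\<close>.\<close>

lemma inverts_parabolic:
  assumes "J \<subseteq> I" "h \<in> parabolic J" "r \<in> carrier W" "inverts h r"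
  shows "r \<in> parabolic J"
proof -
  obtain xs where xs: "set xs \<subseteq> J" "h = cls xs"
    using assms by (auto simp: parabolic_def)
  have "r \<in> set (refls xs)"
    using xs assms inverts_cls[of xs r] by (metis count_notin even_zero order_trans)
  moreover have "set (refls xs) \<subseteq> parabolic J"
    using xs by (intro refls_subgroup subgroup_parabolic assms) (auto simp: parabolic_def)
  ultimately show ?thesis by blast
qed

text \<open>Multiplying by the k-th entry of \<open>refls\<close> deletes the k-th letter. Only the
  letters and the length of the remaining word are recorded, since nothing more is used.\<close>

lemma exchange:
  assumes "set xs \<subseteq> I" "r \<in> set (refls xs)"
  shows "\<exists>ys. set ys \<subseteq> set xs \<and> length xs = Suc (length ys) \<and> r \<otimes>\<^bsub>W\<^esub> cls xs = cls ys"
  using assms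
proof (induction xs arbitrary: r)
  case (Cons x xs)
  show ?case
  proof (cases "r = cls [x]")
    case True
    have "cls [x] \<otimes>\<^bsub>W\<^esub> cls (x # xs) = cls [x, x] \<otimes>\<^bsub>W\<^esub> cls xs"
      using Cons.prems by (simp add: cls_mult)
    thus ?thesis
      using True Cons.prems by (intro exI[of _ xs]) (auto simp: cls_square cls_mult)
  next
    case False
    then obtain t where t: "t \<in> set (refls xs)" "r = conj (cls [x]) t"
      using Cons.prems by auto
    obtain ys where ys: "set ys \<subseteq> set xs" "length xs = Suc (length ys)" "t \<otimes>\<^bsub>W\<^esub> cls xs = cls ys"
      using Cons.IH[OF _ t(1)] Cons.prems by auto
    have "t \<in> carrier W"
      using t refls_carrier Cons.prems by auto
    moreover have "cls (x # xs) = cls [x] \<otimes>\<^bsub>W\<^esub> cls xs"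
      using Cons.prems by (simp add: cls_mult)
    ultimately have "r \<otimes>\<^bsub>W\<^esub> cls (x # xs) = cls [x] \<otimes>\<^bsub>W\<^esub> cls ys"
      using t ys Cons.prems by (simp add: W.m_assoc W.inv_solve_left' flip: ys(3))
    thus ?thesis
      using ys Cons.prems by (intro exI[of _ "x # ys"]) (auto simp: cls_mult)
  qed
qed simp

end

section \<open>Abelian normal subgroups and reflection cocycles\<close>

text \<open>The properties of inversions on which the finiteness argument rests. In the application
  \<open>H\<close> is a parabolic subgroup, \<open>s\<close> a generator outside it and
  \<open>P\<close> is \<open>inverts\<close>.\<close>

locale reflection_cocycle = group G for G (structure) +
  fixes H :: "'a set" and s :: 'a and P :: "'a \<Rightarrow> 'a \<Rightarrow> bool"
  assumes H: "subgroup H G"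
    and s: "s \<in> carrier G" "s \<otimes> s = \<one>" "s \<notin> H"
    and cocycle: "\<And>g h r. \<lbrakk>g \<in> carrier G; h \<in> carrier G; r \<in> carrier G\<rbrakk>
      \<Longrightarrow> P (g \<otimes> h) r \<longleftrightarrow> P g r \<noteq> P h (inv g \<otimes> r \<otimes> g)"
    and P_s: "\<And>r. r \<in> carrier G \<Longrightarrow> P s r \<longleftrightarrow> r = s"
    and P_H: "\<And>h r. \<lbrakk>h \<in> H; r \<in> carrier G; P h r\<rbrakk> \<Longrightarrow> r \<in> H"
    and fin_P: "\<And>g. g \<in> carrier G \<Longrightarrow> finite {r \<in> carrier G. P g r}"
begin

lemma H_carrier: "h \<in> H \<Longrightarrow> h \<in> carrier G"
  using subgroup.subset[OF H] by blast

lemma inv_s: "inv s = s"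
  using s by (simp add: inv_equality)

text \<open>Expanding by the cocycle rule at \<open>s\<close>, the first factor \<open>s\<close>
  contributes true, \<open>h\<close> contributes false because \<open>s\<close> is not in
  \<open>H\<close>, and the last \<open>s\<close> is tested at \<open>inv h s h\<close>.\<close>

lemma P_conj:
  assumes h: "h \<in> H"
  shows "P (s \<otimes> h \<otimes> s) s \<longleftrightarrow> h \<otimes> s \<noteq> s \<otimes> h"
proof -
  have "\<not> P h s"
    using P_H[OF h s(1)] s(3) by blast
  hence "P (s \<otimes> (h \<otimes> s)) s \<longleftrightarrow> inv h \<otimes> s \<otimes> h \<noteq> s"
    using H_carrier[OF h] s P_s by (simp add: cocycle inv_s)
  moreover have "inv h \<otimes> s \<otimes> h = s \<longleftrightarrow> h \<otimes> s = s \<otimes> h"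
  proof -
    have "inv h \<otimes> s \<otimes> h = inv h \<otimes> (s \<otimes> h)"
      using H_carrier[OF h] s by (simp add: m_assoc)
    moreover have "s = inv h \<otimes> (s \<otimes> h) \<longleftrightarrow> s \<otimes> h = h \<otimes> s"
      using H_carrier[OF h] s by (intro inv_solve_left) auto
    ultimately show ?thesis by metis
  qed
  ultimately show ?thesis
    using H_carrier[OF h] s by (simp add: m_assoc)
qed

text \<open>If \<open>h\<close> and \<open>s\<close> did not commute, \<open>P_conj\<close> would
  make \<open>s\<close> an inversion of an element of \<open>H\<close>, forcing \<open>s\<close>
  into \<open>H\<close>.\<close>

lemma commutes_if_conj_mem: "h \<in> H \<Longrightarrow> s \<otimes> h \<otimes> s \<in> H \<Longrightarrow> h \<otimes> s = s \<otimes> h"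
  using P_conj[of h] P_H[of "s \<otimes> h \<otimes> s" s] s by blast

lemma finite_normal_abelian_inter:
  assumes N: "N \<lhd> G"
    and comm: "\<And>x y. x \<in> N \<Longrightarrow> y \<in> N \<Longrightarrow> x \<otimes> y = y \<otimes> x"
    and fin_C: "finite {h \<in> H. h \<otimes> s = s \<otimes> h}"
  shows "finite (N \<inter> H)"
proof (rule ccontr)
  assume inf: "infinite (N \<inter> H)"
  define C where "C = {h \<in> H. h \<otimes> s = s \<otimes> h}"
  have "finite C"
    using fin_C by (simp add: C_def)
  interpret N: normal N G by (rule N)
  note HG = H_carrier
  note Hcl = subgroup.m_closed[OF H] subgroup.m_inv_closed[OF H]
  have ss: "s \<otimes> (s \<otimes> x) = x" if "x \<in> carrier G" for x
    using that s by (simp flip: m_assoc)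
  have cancel: "inv x \<otimes> (x \<otimes> y) = y" "x \<otimes> (inv x \<otimes> y) = y"
    if "x \<in> carrier G" "y \<in> carrier G" for x y
    using that by (simp_all flip: m_assoc)
  have conj_H: "x \<in> H" if "h \<in> H" "x \<in> carrier G" "h \<otimes> x \<otimes> inv h \<in> H" for h x
  proof -
    have "inv h \<otimes> (h \<otimes> x \<otimes> inv h) \<otimes> h = x"
      using that(2) HG[OF that(1)] by (simp add: m_assoc cancel)
    moreover have "inv h \<otimes> (h \<otimes> x \<otimes> inv h) \<otimes> h \<in> H"
      using that(1,3) Hcl by blast
    ultimately show ?thesis by simp
  qed
  have conj_N: "s \<otimes> a \<otimes> s \<in> N" if "a \<in> N" for a
    using N.inv_op_closed2[OF s(1) that] by (simp add: inv_s)
  \<comment> \<open>Otherwise \<open>P (s a s)\<close> would hold at all conjugates of \<open>s\<close> under \<open>N \<inter> H\<close>, which are infinitely many.\<close>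
  have key: "s \<otimes> inv a \<otimes> s \<otimes> a \<otimes> s \<in> H" if a: "a \<in> N \<inter> H" "a \<notin> C" for a
  proof (rule ccontr)
    assume notin: "s \<otimes> inv a \<otimes> s \<otimes> a \<otimes> s \<notin> H"
    define c where "c = s \<otimes> a \<otimes> s"
    have aG: "a \<in> carrier G" using a HG by blast
    have c: "c \<in> N" "c \<in> carrier G"
      using a conj_N s aG by (auto simp: c_def)
    have cs: "inv c \<otimes> s \<otimes> c = s \<otimes> inv a \<otimes> s \<otimes> a \<otimes> s"
      using s aG by (simp add: c_def inv_mult_group inv_s m_assoc ss)
    \<comment> \<open>Evaluate \<open>P\<close> at \<open>x s x^-1\<close> for the equal products
      \<open>x c\<close> and \<open>c x\<close>. The first gives true via \<open>P c s\<close>; if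
      \<open>P c\<close> fails there, the second makes \<open>x\<close> invert a conjugate of
      \<open>inv c s c\<close>, which puts that element into \<open>H\<close>.\<close>
    have "P c (x \<otimes> s \<otimes> inv x)" if x: "x \<in> N \<inter> H" for x
    proof (rule ccontr)
      assume no: "\<not> P c (x \<otimes> s \<otimes> inv x)"
      have xG: "x \<in> carrier G" using x HG by blast
      let ?t = "x \<otimes> s \<otimes> inv x"
      have t: "?t \<in> carrier G" "?t \<notin> H"
        using conj_H[of x s] x s xG by auto
      have "inv x \<otimes> ?t \<otimes> x = s"
        using xG s by (simp add: m_assoc cancel)
      moreover have "P c s"
        using P_conj[of a] a by (auto simp: c_def C_def)
      moreover have "\<not> P x ?t"
        using P_H[of x ?t] t x by blast
      ultimately have "P (x \<otimes> c) ?t"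
        using t xG c by (simp add: cocycle)
      hence "P (c \<otimes> x) ?t"
        using comm[of x c] x c by auto
      hence "P x (inv c \<otimes> ?t \<otimes> c)"
        using no t c xG by (simp add: cocycle)
      hence "inv c \<otimes> ?t \<otimes> c \<in> H"
        using P_H[of x] x c t by simp
      moreover have "inv c \<otimes> ?t \<otimes> c = x \<otimes> (inv c \<otimes> s \<otimes> c) \<otimes> inv x"
      proof -
        have *: "inv c \<otimes> x = x \<otimes> inv c" "inv x \<otimes> c = c \<otimes> inv x"
          using comm x c by (auto simp: N.m_inv_closed)
        have "inv c \<otimes> ?t \<otimes> c = (inv c \<otimes> x) \<otimes> s \<otimes> (inv x \<otimes> c)"
          using xG c s by (simp add: m_assoc)
        thus ?thesis
          unfolding * using xG c s by (simp add: m_assoc)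
      qed
      ultimately have "inv c \<otimes> s \<otimes> c \<in> H"
        using conj_H[of x "inv c \<otimes> s \<otimes> c"] x c s by simp
      thus False using notin cs by simp
    qed
    hence sub: "N \<inter> H \<subseteq> (\<lambda>x. x \<otimes> s \<otimes> inv x) -` {r \<in> carrier G. P c r} \<inter> (N \<inter> H)"
      using HG s by auto
    have "finite ((\<lambda>x. x \<otimes> s \<otimes> inv x) -` {r \<in> carrier G. P c r} \<inter> (N \<inter> H))"
    proof (rule finite_finite_vimage_IntI)
      show "finite {r \<in> carrier G. P c r}" using fin_P c by blast
      fix r
      show "finite ((\<lambda>x. x \<otimes> s \<otimes> inv x) -` {r} \<inter> (N \<inter> H))" (is "finite ?F")
      proof (cases "?F = {}")
        case False
        then obtain y where y: "y \<in> H" "y \<otimes> s \<otimes> inv y = r" by auto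
        \<comment> \<open>Two elements of \<open>H\<close> conjugate \<open>s\<close> to the same
          element only if they lie in the same left coset of the centralizer \<open>C\<close>, so
          fibres are finite.\<close>
        have "?F \<subseteq> (\<lambda>z. y \<otimes> z) ` C"
        proof
          fix x assume "x \<in> ?F"
          hence x: "x \<in> H" "x \<otimes> s \<otimes> inv x = y \<otimes> s \<otimes> inv y" using y by auto
          have G: "x \<in> carrier G" "y \<in> carrier G" using x y HG by auto
          have "(inv y \<otimes> x) \<otimes> s = inv y \<otimes> (x \<otimes> s \<otimes> inv x) \<otimes> x"
            using G s by (simp add: m_assoc)
          also have "\<dots> = s \<otimes> (inv y \<otimes> x)"
            unfolding x(2) using G s by (simp add: m_assoc cancel)
          finally have "inv y \<otimes> x \<in> C"
            using x y Hcl by (auto simp: C_def)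
          moreover have "x = y \<otimes> (inv y \<otimes> x)"
            using G by (simp add: cancel)
          ultimately show "x \<in> (\<lambda>z. y \<otimes> z) ` C" by blast
        qed
        thus ?thesis
          using \<open>finite C\<close> by (rule finite_subset[OF _ finite_imageI])
      qed simp
    qed
    thus False
      using inf finite_subset[OF sub] by simp
  qed
  have "\<not> N \<inter> H \<subseteq> C"
    using inf finite_subset \<open>finite C\<close> by metis
  then obtain a where a: "a \<in> N \<inter> H" "a \<notin> C"
    by blast
  \<comment> \<open>Fix one \<open>a\<close> outside \<open>C\<close>. Any other \<open>b\<close>
    outside \<open>C\<close> turns out to lie in the coset of \<open>a\<close>, so two cosets of the
    finite \<open>C\<close> suffice.\<close>
  have "N \<inter> H \<subseteq> C \<union> (\<lambda>z. a \<otimes> z) ` C"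
  proof
    fix b assume b: "b \<in> N \<inter> H"
    show "b \<in> C \<union> (\<lambda>z. a \<otimes> z) ` C"
    proof (cases "b \<in> C")
      case False
      have G: "a \<in> carrier G" "b \<in> carrier G" using a b HG by auto
      let ?r = "\<lambda>a. s \<otimes> inv a \<otimes> s \<otimes> a \<otimes> s"
      have N': "s \<otimes> inv a \<otimes> s \<in> N" "a \<otimes> inv b \<in> N"
        using a b conj_N by (auto simp: N.m_inv_closed)
      \<comment> \<open>By \<open>key\<close> both factors lie in \<open>H\<close>. Swapping the
        commuting elements \<open>s a^-1 s\<close> and \<open>a b^-1\<close> of \<open>N\<close>
        isolates the conjugate \<open>s (a^-1 b) s\<close>, which is therefore in \<open>H\<close>,
        and \<open>commutes_if_conj_mem\<close> applies.\<close>
      have "?r a \<otimes> inv (?r b) = (s \<otimes> inv a \<otimes> s) \<otimes> (a \<otimes> inv b) \<otimes> (s \<otimes> b \<otimes> s)"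
        using G s by (simp add: inv_mult_group inv_s m_assoc ss)
      also have "\<dots> = (a \<otimes> inv b) \<otimes> (s \<otimes> inv a \<otimes> s) \<otimes> (s \<otimes> b \<otimes> s)"
        using comm[OF N'] by simp
      also have "\<dots> = (a \<otimes> inv b) \<otimes> (s \<otimes> (inv a \<otimes> b) \<otimes> s)"
        using G s by (simp add: m_assoc ss)
      finally have eq: "?r a \<otimes> inv (?r b) = (a \<otimes> inv b) \<otimes> (s \<otimes> (inv a \<otimes> b) \<otimes> s)" .
      have "inv (a \<otimes> inv b) \<otimes> (?r a \<otimes> inv (?r b)) \<in> H"
        using a b False by (intro Hcl(1)[OF Hcl(2)[OF Hcl(1)[OF _ Hcl(2)]] Hcl(1)[OF _ Hcl(2)]] key) auto
      moreover have "inv (a \<otimes> inv b) \<otimes> (?r a \<otimes> inv (?r b)) = s \<otimes> (inv a \<otimes> b) \<otimes> s"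
        unfolding eq using G s by (simp add: cancel)
      ultimately have "inv a \<otimes> b \<in> C"
        using a b commutes_if_conj_mem[of "inv a \<otimes> b"] by (auto simp: C_def intro: Hcl)
      moreover have "b = a \<otimes> (inv a \<otimes> b)"
        using G by (simp add: cancel)
      ultimately show ?thesis by blast
    qed simp
  qed
  moreover have "finite (C \<union> (\<lambda>z. a \<otimes> z) ` C)"
    using \<open>finite C\<close> by simp
  ultimately show False
    using inf finite_subset by metis
qed

end

text \<open>On \<open>H\<close>, the fibres of the map sending \<open>h\<close> to its coset of
  \<open>N\<close> lie in translates of \<open>N \<inter> H\<close>, and there are finitely many
  cosets.\<close>

lemma (in group) finite_if_finite_inter_finite_index:
  assumes H: "subgroup H G" and N: "subgroup N G"
    and "finite (N \<inter> H)" "finite (rcosets N)"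
  shows "finite H"
proof -
  have HG: "H \<subseteq> carrier G" using subgroup.subset[OF H] .
  have "finite ((\<lambda>h. N #> h) -` (rcosets N) \<inter> H)"
  proof (rule finite_finite_vimage_IntI[OF assms(4)])
    fix X
    show "finite ((\<lambda>h. N #> h) -` {X} \<inter> H)" (is "finite ?F")
    proof (cases "?F = {}")
      case False
      then obtain y where y: "y \<in> H" "N #> y = X" by auto
      have "?F \<subseteq> (\<lambda>z. z \<otimes> y) ` (N \<inter> H)"
      proof
        fix x assume "x \<in> ?F"
        hence x: "x \<in> H" "N #> x = N #> y" using y by auto
        have G: "x \<in> carrier G" "y \<in> carrier G" using x y HG by auto
        have "x \<in> N #> y"
          using x(2) rcos_self[OF G(1) N] by simp
        hence "x \<otimes> inv y \<in> N"
          using G N by (metis subgroup.rcos_module_imp is_group)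
        moreover have "x \<otimes> inv y \<in> H"
          using x y by (intro subgroup.m_closed[OF H] subgroup.m_inv_closed[OF H])
        moreover have "x = (x \<otimes> inv y) \<otimes> y"
          using G by (simp add: m_assoc)
        ultimately show "x \<in> (\<lambda>z. z \<otimes> y) ` (N \<inter> H)" by blast
      qed
      thus ?thesis using assms(3) by (rule finite_subset[OF _ finite_imageI])
    qed simp
  qed
  moreover have "(\<lambda>h. N #> h) -` (rcosets N) \<inter> H = H"
    using HG subgroup.subset[OF N] by (auto intro: rcosetsI)
  ultimately show ?thesis by simp
qed

section \<open>The dual geometric representation\<close>

context coxeter_presentation
begin

text \<open>Tits' bilinear form on the simple roots; \<open>- 1\<close> is the limit of
  \<open>- cos (pi / k)\<close> as \<open>k\<close> grows.\<close>

definition cox_form :: "'i \<Rightarrow> 'i \<Rightarrow> real" where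
  "cox_form i j = (case m i j of enat k \<Rightarrow> - cos (pi / real k) | \<infinity> \<Rightarrow> - 1)"

text \<open>
  Functionals on the geometric representation, given by their values on the simple roots. Working in
  the dual makes it immediate that \<open>W\<^sub>J\<close> fixes every functional vanishing on \<open>J\<close>.
\<close>

definition act :: "'i \<Rightarrow> ('i \<Rightarrow> real) \<Rightarrow> 'i \<Rightarrow> real" where
  "act i f = (\<lambda>k. f k - 2 * cox_form i k * f i)"

lemma cox_form_self: "i \<in> I \<Longrightarrow> cox_form i i = 1"
  using coxeter_matrix by (simp add: cox_form_def coxeter_matrix_def one_enat_def)

lemma cox_form_sym: "i \<in> I \<Longrightarrow> j \<in> I \<Longrightarrow> cox_form i j = cox_form j i"
  using coxeter_matrix by (simp add: cox_form_def coxeter_matrix_def)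

text \<open>
  The successive values of the coordinate being negated satisfy \<open>z\<^sub>t\<^sub>+\<^sub>1 = 2 cos \<theta> z\<^sub>t - z\<^sub>t\<^sub>-\<^sub>1\<close>, whence
  the sines; the third formula is their telescoped sum.
\<close>

lemma act_alt_word:
  fixes f :: "'i \<Rightarrow> real"
  assumes ij: "i \<in> I" "j \<in> I" and form: "cox_form i j = - cos \<theta>"
  defines "F \<equiv> \<lambda>l. foldr act (alt_word i j (2 * l)) f"
  defines "X \<equiv> \<lambda>l::nat. 2 * real l * \<theta>"
  shows "sin \<theta> * F l j = f j * sin (X l + \<theta>) + f i * sin (X l)
    \<and> sin \<theta> * F l i = - (f j * sin (X l) + f i * sin (X l - \<theta>))
    \<and> (\<forall>k. (sin \<theta>)\<^sup>2 * F l k = (sin \<theta>)\<^sup>2 * f k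
        - cox_form j k * (f j * (1 - cos (X l)) + f i * (cos \<theta> - cos (X l - \<theta>)))
        - cox_form i k * (f j * (cos \<theta> - cos (X l + \<theta>)) + f i * (1 - cos (X l))))"
proof (induction l)
  case 0
  show ?case by (simp add: F_def X_def alt_word_def algebra_simps)
next
  case (Suc l)
  \<comment> \<open>In these variables the claims become polynomial identities modulo the two
    Pythagorean relations, within reach of \<open>algebra\<close>. The factors
    \<open>sin \<theta>\<close> in the statement avoid division.\<close>
  define S c x y where "S = sin \<theta>" and "c = cos \<theta>" and "x = sin (X l)" and "y = cos (X l)"
  have 1: "S\<^sup>2 + c\<^sup>2 = 1" "x\<^sup>2 + y\<^sup>2 = 1" by (auto simp: S_def c_def x_def y_def)
  have XS: "X (Suc l) = X l + (\<theta> + \<theta>)" by (simp add: X_def algebra_simps)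
  have [simp]: "cox_form i j = - c" "cox_form j i = - c" "cox_form i i = 1" "cox_form j j = 1"
    using ij form by (auto simp: c_def cox_form_self cox_form_sym[of j i])
  have "F (Suc l) = act i (act j (F l))"
    by (simp add: F_def alt_word_Suc)
  hence FS: "F (Suc l) k = F l k - 2 * cox_form j k * F l j
      - 2 * cox_form i k * (F l i + 2 * c * F l j)" for k
    by (simp add: act_def)
  have trig: "sin (X l + \<theta>) = x * c + y * S" "sin (X l - \<theta>) = x * c - y * S"
    "cos (X l + \<theta>) = y * c - x * S" "cos (X l - \<theta>) = y * c + x * S"
    by (simp_all add: x_def y_def S_def c_def sin_add cos_add sin_diff cos_diff)
  have 2: "sin (\<theta> + \<theta>) = 2 * S * c" "cos (\<theta> + \<theta>) = c * c - S * S"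
    unfolding sin_add cos_add S_def c_def by simp_all
  have trig': "sin (X (Suc l)) = x * (c * c - S * S) + y * (2 * S * c)"
    "cos (X (Suc l)) = y * (c * c - S * S) - x * (2 * S * c)"
    "sin (X (Suc l) + \<theta>) = (x * (c * c - S * S) + y * (2 * S * c)) * c + (y * (c * c - S * S) - x * (2 * S * c)) * S"
    "cos (X (Suc l) + \<theta>) = (y * (c * c - S * S) - x * (2 * S * c)) * c - (x * (c * c - S * S) + y * (2 * S * c)) * S"
    "sin (X (Suc l) - \<theta>) = x * c + y * S" "cos (X (Suc l) - \<theta>) = y * c - x * S"
  proof -
    have X': "X (Suc l) - \<theta> = X l + \<theta>" by (simp add: XS)
    show *: "sin (X (Suc l)) = x * (c * c - S * S) + y * (2 * S * c)"
      "cos (X (Suc l)) = y * (c * c - S * S) - x * (2 * S * c)"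
      unfolding XS sin_add[of "X l"] cos_add[of "X l"] 2 x_def y_def by simp_all
    show "sin (X (Suc l) + \<theta>) = (x * (c * c - S * S) + y * (2 * S * c)) * c + (y * (c * c - S * S) - x * (2 * S * c)) * S"
      "cos (X (Suc l) + \<theta>) = (y * (c * c - S * S) - x * (2 * S * c)) * c - (x * (c * c - S * S) + y * (2 * S * c)) * S"
      unfolding sin_add[of _ \<theta>] cos_add[of _ \<theta>] * by (simp_all add: S_def c_def)
    show "sin (X (Suc l) - \<theta>) = x * c + y * S" "cos (X (Suc l) - \<theta>) = y * c - x * S"
      unfolding X' trig by simp_all
  qed
  have Fj: "S * F l j = f j * (x * c + y * S) + f i * x"
    and Fi: "S * F l i = - (f j * x + f i * (x * c - y * S))"
    and Fk: "S\<^sup>2 * F l k = S\<^sup>2 * f k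
        - cox_form j k * (f j * (1 - y) + f i * (c - (y * c + x * S)))
        - cox_form i k * (f j * (c - (y * c - x * S)) + f i * (1 - y))" for k
    using Suc unfolding trig S_def[symmetric] c_def[symmetric] x_def[symmetric] y_def[symmetric]
    by auto
  show ?case
    unfolding trig' S_def[symmetric] c_def[symmetric]
  proof (intro conjI allI)
    have "F (Suc l) j = - F l j + 2 * c * (F l i + 2 * c * F l j)"
      by (simp add: FS)
    thus "S * F (Suc l) j = f j * ((x * (c * c - S * S) + y * (2 * S * c)) * c + (y * (c * c - S * S) - x * (2 * S * c)) * S)
      + f i * (x * (c * c - S * S) + y * (2 * S * c))"
      using Fi Fj 1 by algebra
    have "F (Suc l) i = - F l i - 2 * c * F l j"
      by (simp add: FS)
    thus "S * F (Suc l) i = - (f j * (x * (c * c - S * S) + y * (2 * S * c)) + f i * (x * c + y * S))"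
      using Fi Fj 1 by algebra
    show "S\<^sup>2 * F (Suc l) k = S\<^sup>2 * f k
        - cox_form j k * (f j * (1 - (y * (c * c - S * S) - x * (2 * S * c))) + f i * (c - (y * c - x * S)))
        - cox_form i k * (f j * (c - ((y * (c * c - S * S) - x * (2 * S * c)) * c - (x * (c * c - S * S) + y * (2 * S * c)) * S))
          + f i * (1 - (y * (c * c - S * S) - x * (2 * S * c))))" for k
      using FS[of k] Fi Fj Fk[of k] 1 by algebra
  qed
qed

text \<open>With \<open>\<theta> = pi / n\<close> the total angle is \<open>2 * pi\<close> and all
  correction terms in \<open>act_alt_word\<close> vanish. The case \<open>i = j\<close> is separate
  because there \<open>sin \<theta> = 0\<close> and the factor could not be cancelled.\<close>

lemma act_relator:
  assumes "i \<in> I" "j \<in> I" "m i j = enat n"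
  shows "foldr act (alt_word i j (2 * n)) f = f"
proof (cases "i = j")
  case True
  hence "n = 1"
    using assms coxeter_matrix by (simp add: coxeter_matrix_def one_enat_def)
  thus ?thesis
    using True assms
    by (auto simp: alt_word_def numeral_2_eq_2 act_def cox_form_self)
next
  case False
  define \<theta> where "\<theta> = pi / real n"
  have "m i j \<ge> 2"
    using False assms(1,2) coxeter_matrix by (auto simp: coxeter_matrix_def)
  hence n: "n \<ge> 2"
    using assms by (simp add: numeral_eq_enat)
  have "\<theta> > 0" "\<theta> < pi"
    using n by (auto simp: \<theta>_def field_simps)
  hence "sin \<theta> \<noteq> 0"
    using sin_gt_zero by fastforce
  have \<theta>: "2 * real n * \<theta> = 2 * pi"
    using n by (simp add: \<theta>_def)
  have form: "cox_form i j = - cos \<theta>"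
    using assms by (simp add: cox_form_def \<theta>_def)
  have "(sin \<theta>)\<^sup>2 * foldr act (alt_word i j (2 * n)) f k = (sin \<theta>)\<^sup>2 * f k" for k
    using act_alt_word[OF assms(1,2) form, where l = n and f = f]
    unfolding \<theta> by (auto simp: cos_add cos_diff)
  thus ?thesis
    using \<open>sin \<theta> \<noteq> 0\<close> by auto
qed

lemma act_cong: "cox_eq I m xs ys \<Longrightarrow> foldr act xs f = foldr act ys f"
  by (induction arbitrary: f rule: cox_eq.induct) (auto simp: act_relator)

lemma act_cls: "set xs \<subseteq> I \<Longrightarrow> cls xs = cls ys \<Longrightarrow> foldr act xs f = foldr act ys f"
  by (simp add: cls_eq_iff act_cong)

text \<open>The functional dual to the simple root of \<open>i\<close> vanishes on \<open>J\<close>,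
  so words over \<open>J\<close> fix it, whereas \<open>act i\<close> changes its value at
  \<open>i\<close> from 1 to -1.\<close>

lemma generator_notin_parabolic:
  assumes "i \<in> I" "i \<notin> J"
  shows "cls [i] \<notin> parabolic J"
proof
  assume "cls [i] \<in> parabolic J"
  then obtain xs where xs: "set xs \<subseteq> J" "cls [i] = cls xs"
    by (auto simp: parabolic_def)
  define f :: "'i \<Rightarrow> real" where "f = (\<lambda>k. of_bool (k = i))"
  have "foldr act xs f = f"
    using xs(1) assms(2) by (induction xs) (auto simp: act_def f_def)
  hence "act i f i = f i"
    using act_cls[OF _ xs(2), of f] assms by simp
  thus False
    using assms by (simp add: act_def f_def cox_form_self)
qed

text \<open>Applied to the functional dual to \<open>i\<close> and evaluated at \<open>j\<close>,
  the two orders give \<open>-2 B\<close> and \<open>2 B\<close> with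
  \<open>B = cox_form i j\<close>. So \<open>B = 0\<close>, which happens only for
  \<open>m i j = 2\<close>.\<close>

lemma commuting_generators:
  assumes ij: "i \<in> I" "j \<in> I" "i \<noteq> j"
    and comm: "cls [i] \<otimes>\<^bsub>W\<^esub> cls [j] = cls [j] \<otimes>\<^bsub>W\<^esub> cls [i]"
  shows "m i j = 2"
proof -
  define f :: "'i \<Rightarrow> real" where "f = (\<lambda>k. of_bool (k = i))"
  have "cls [i, j] = cls [j, i]"
    using ij comm by (simp add: cls_mult)
  hence "act i (act j f) j = act j (act i f) j"
    using act_cls[of "[i, j]" "[j, i]" f] ij by simp
  hence "cox_form i j = 0"
    using ij by (simp add: act_def f_def cox_form_self)
  then obtain n where n: "m i j = enat n" "cos (pi / real n) = 0"
    by (auto simp: cox_form_def split: enat.splits)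
  have "m i j \<ge> 2"
    using ij coxeter_matrix by (auto simp: coxeter_matrix_def)
  hence "n \<ge> 2"
    using n by (simp add: numeral_eq_enat)
  moreover have "\<not> n > 2"
  proof
    assume "n > 2"
    hence "0 < pi / real n" "pi / real n < pi / 2"
      by (auto simp: field_simps)
    thus False using cos_gt_zero n(2) by fastforce
  qed
  ultimately show ?thesis
    using n by (simp add: numeral_eq_enat)
qed

end

section \<open>Finiteness\<close>

context coxeter_presentation
begin

section \<open>Centralizers of generators and finiteness of proper parabolic subgroups\<close>

lemma reflection_cocycle_parabolic:
  assumes "J \<subseteq> I" "i \<in> I" "i \<notin> J"
  shows "reflection_cocycle W (parabolic J) (cls [i]) inverts"
proof (intro reflection_cocycle.intro reflection_cocycle_axioms.intro)
  show "group W"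
    by (rule W.is_group)
  show "subgroup (parabolic J) W"
    using assms by (intro subgroup_parabolic)
  show "cls [i] \<in> carrier W" "cls [i] \<otimes>\<^bsub>W\<^esub> cls [i] = \<one>\<^bsub>W\<^esub>" "cls [i] \<notin> parabolic J"
    using assms generator_notin_parabolic by (auto simp: cls_mult cls_square one_W)
  show "inverts (g \<otimes>\<^bsub>W\<^esub> h) r \<longleftrightarrow> inverts g r \<noteq> inverts h (inv\<^bsub>W\<^esub> g \<otimes>\<^bsub>W\<^esub> r \<otimes>\<^bsub>W\<^esub> g)"
    if "g \<in> carrier W" "h \<in> carrier W" "r \<in> carrier W" for g h r
    using inverts_mult[OF that] that by simp
  show "inverts (cls [i]) r \<longleftrightarrow> r = cls [i]" if "r \<in> carrier W" for r
    using that assms by (simp add: inverts_generator)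
  show "r \<in> parabolic J" if "h \<in> parabolic J" "r \<in> carrier W" "inverts h r" for h r
    using that assms inverts_parabolic by blast
  show "finite {r \<in> carrier W. inverts g r}" if "g \<in> carrier W" for g
    using that by (rule finite_inverts)
qed

text \<open>Induction on word length: either the word can be shortened by \<open>exchange\<close>,
  or its first letter commutes with \<open>s\<close> and can be split off, leaving a shorter word
  that still commutes with \<open>s\<close>.\<close>

lemma centralizer_parabolic:
  assumes J: "J \<subseteq> I" and i: "i \<in> I" "i \<notin> J"
    and "set xs \<subseteq> J" "cls xs \<otimes>\<^bsub>W\<^esub> cls [i] = cls [i] \<otimes>\<^bsub>W\<^esub> cls xs"
  shows "cls xs \<in> parabolic {j \<in> J. m i j = 2}"
  using assms(4,5)
proof (induction xs rule: length_induct)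
  case (1 xs)
  interpret C: reflection_cocycle W "parabolic J" "cls [i]" inverts
    using J i by (rule reflection_cocycle_parabolic)
  define s where "s = cls [i]"
  show ?case
  proof (cases xs)
    case Nil
    then show ?thesis by (auto simp: parabolic_def)
  next
    case (Cons y ys)
    define u where "u = cls [y]"
    have y: "y \<in> J" "y \<in> I" "set ys \<subseteq> I" using Cons 1 J by auto
    have xs: "cls xs = u \<otimes>\<^bsub>W\<^esub> cls ys" "cls xs \<in> parabolic J" "cls xs \<in> carrier W"
      using Cons y 1 J by (auto simp: cls_mult u_def parabolic_def)
    have G: "s \<in> carrier W" "u \<in> carrier W" "inv\<^bsub>W\<^esub> s = s" "inv\<^bsub>W\<^esub> u = u"
      "s \<otimes>\<^bsub>W\<^esub> s = \<one>\<^bsub>W\<^esub>" "u \<otimes>\<^bsub>W\<^esub> u = \<one>\<^bsub>W\<^esub>" "cls ys \<in> carrier W"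
      using i y by (auto simp: s_def u_def inv_cls cls_mult cls_square one_W)
    have uH: "u \<in> parabolic J"
      using y by (auto simp: u_def parabolic_def)
    have cancel: "s \<otimes>\<^bsub>W\<^esub> (s \<otimes>\<^bsub>W\<^esub> x) = x" "u \<otimes>\<^bsub>W\<^esub> (u \<otimes>\<^bsub>W\<^esub> x) = x" if "x \<in> carrier W" for x
      using that G by (simp_all flip: W.m_assoc)
    have comm: "cls xs \<otimes>\<^bsub>W\<^esub> s = s \<otimes>\<^bsub>W\<^esub> cls xs"
      using 1 by (simp add: s_def)
    show ?thesis
    proof (cases "u \<in> set (refls ys)")
      case True
      obtain zs where zs: "set zs \<subseteq> set ys" "length ys = Suc (length zs)" "u \<otimes>\<^bsub>W\<^esub> cls ys = cls zs"
        using exchange[OF y(3) True] by blast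
      have "cls zs = cls xs"
        using zs xs by simp
      moreover have "length zs < length xs" "set zs \<subseteq> J"
        using zs Cons 1 by auto
      ultimately show ?thesis
        using "1.IH"[rule_format, of zs] "1.prems" by simp
    next
      case False
      hence "\<not> inverts (cls ys) u"
        using y G by (simp add: inverts_cls count_list_0_iff)
      hence inv_u: "inverts (cls xs) u"
        using y G inverts_generator[of y u] by (simp add: xs inverts_mult) (simp add: u_def)
      \<comment> \<open>Evaluating inversions of \<open>s (cls xs) = (cls xs) s\<close> at
        \<open>t\<close> turns the inversion \<open>u\<close> of \<open>cls xs\<close> into the
        inversion \<open>t\<close>. Hence \<open>t = s u s\<close> lies in the parabolic subgroup
        and \<open>u\<close> commutes with \<open>s\<close>.\<close>
      define t where "t = s \<otimes>\<^bsub>W\<^esub> u \<otimes>\<^bsub>W\<^esub> s"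
      have t: "t \<in> carrier W" "s \<otimes>\<^bsub>W\<^esub> t \<otimes>\<^bsub>W\<^esub> s = u"
        using G by (simp_all add: t_def W.m_assoc cancel)
      have ts: "t \<noteq> s"
      proof
        assume "t = s"
        hence "u = s" using t G by simp
        thus False using uH C.s(3) by (simp add: s_def)
      qed
      have "inverts (s \<otimes>\<^bsub>W\<^esub> cls xs) t"
        using inv_u t ts G xs i inverts_generator[of i t] by (simp add: inverts_mult) (simp add: s_def)
      hence "inverts (cls xs \<otimes>\<^bsub>W\<^esub> s) t"
        by (simp add: comm)
      moreover have "conj (inv\<^bsub>W\<^esub> (cls xs)) t \<noteq> s"
      proof
        assume "conj (inv\<^bsub>W\<^esub> (cls xs)) t = s"
        hence "t = conj (cls xs) s"
          using conj_mult[of "cls xs" "inv\<^bsub>W\<^esub> (cls xs)" t] xs(3) t by simp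
        also have "\<dots> = s"
          using comm G xs(3) by (simp add: W.m_assoc)
        finally show False using ts by simp
      qed
      ultimately have "inverts (cls xs) t"
        using xs(3) t G i inverts_generator[of i "conj (inv\<^bsub>W\<^esub> (cls xs)) t"]
        by (simp add: inverts_mult) (simp add: s_def)
      hence "t \<in> parabolic J"
        using inverts_parabolic[OF J xs(2) t(1)] by simp
      hence us: "u \<otimes>\<^bsub>W\<^esub> s = s \<otimes>\<^bsub>W\<^esub> u"
        using C.commutes_if_conj_mem[OF uH] by (simp add: t_def s_def)
      hence "m i y = 2"
        using i y commuting_generators[of i y] by (auto simp: u_def s_def)
      have ys: "cls ys = u \<otimes>\<^bsub>W\<^esub> cls xs"
        using G by (simp add: xs cancel)
      have "cls ys \<otimes>\<^bsub>W\<^esub> s = s \<otimes>\<^bsub>W\<^esub> cls ys"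
      proof -
        have "cls ys \<otimes>\<^bsub>W\<^esub> s = u \<otimes>\<^bsub>W\<^esub> (s \<otimes>\<^bsub>W\<^esub> cls xs)"
          unfolding ys using G xs(3) comm by (simp add: W.m_assoc)
        also have "\<dots> = (s \<otimes>\<^bsub>W\<^esub> u) \<otimes>\<^bsub>W\<^esub> cls xs"
          using G xs(3) us by (simp flip: W.m_assoc)
        finally show ?thesis
          unfolding ys using G xs(3) by (simp add: W.m_assoc)
      qed
      hence "cls ys \<in> parabolic {j \<in> J. m i j = 2}"
        using 1 Cons by (auto simp: s_def)
      moreover have "u \<in> parabolic {j \<in> J. m i j = 2}"
        using y \<open>m i y = 2\<close> by (auto simp: u_def parabolic_def intro!: image_eqI[of _ _ "[y]"])
      moreover have "subgroup (parabolic {j \<in> J. m i j = 2}) W"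
        using J by (intro subgroup_parabolic) auto
      ultimately show ?thesis
        unfolding xs(1) by (intro subgroup.m_closed)
    qed
  qed
qed

lemma finite_proper_parabolic:
  assumes fin: "finite I" and irr: "cox_irreducible I m" and aff: "affine_coxeter I m"
    and "J \<subset> I"
  shows "finite (parabolic J)"
proof -
  obtain N where N: "N \<lhd> W" "comm_group (W\<lparr>carrier := N\<rparr>)" "finite (rcosets\<^bsub>W\<^esub> N)"
    using aff by (auto simp: affine_coxeter_def)
  have comm: "x \<otimes>\<^bsub>W\<^esub> y = y \<otimes>\<^bsub>W\<^esub> x" if "x \<in> N" "y \<in> N" for x y
    using that N(2) by (auto simp: comm_group_def dest: comm_monoid.m_comm)
  have "finite J"
    using fin \<open>J \<subset> I\<close> finite_subset by blast
  thus ?thesis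
    using \<open>J \<subset> I\<close>
  proof (induction J rule: finite_psubset_induct)
    case (psubset J)
    show ?case
    proof (cases "J = {}")
      case True
      then show ?thesis by (simp add: parabolic_def)
    next
      case False
      let ?R = "{(a, b). a \<in> I \<and> b \<in> I \<and> a \<noteq> b \<and> m a b \<noteq> 2}"
      obtain a b where ab: "a \<in> J" "b \<in> I" "b \<notin> J"
        using False psubset.prems by blast
      hence "(a, b) \<in> ?R\<^sup>*"
        using irr psubset.prems by (auto simp: cox_irreducible_def)
      \<comment> \<open>A path in the Coxeter graph from inside \<open>J\<close> to outside must
        cross the boundary along some edge.\<close>
      hence "b \<in> J \<or> (\<exists>i j. i \<in> I - J \<and> j \<in> J \<and> m j i \<noteq> 2)"
        by (induction rule: rtrancl_induct) (use ab in auto)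
      then obtain i j where ij: "i \<in> I" "i \<notin> J" "j \<in> J" "m j i \<noteq> 2"
        using ab by blast
      moreover have "m i j = m j i"
        using ij psubset.prems coxeter_matrix by (auto simp: coxeter_matrix_def)
      ultimately have "m i j \<noteq> 2"
        by simp
      interpret C: reflection_cocycle W "parabolic J" "cls [i]" inverts
        using psubset.prems ij by (intro reflection_cocycle_parabolic) auto
      have "{h \<in> parabolic J. h \<otimes>\<^bsub>W\<^esub> cls [i] = cls [i] \<otimes>\<^bsub>W\<^esub> h} \<subseteq> parabolic {j \<in> J. m i j = 2}"
        using centralizer_parabolic[of J i] psubset.prems ij by (auto simp: parabolic_def[of J])
      \<comment> \<open>The endpoint \<open>j\<close> of the crossing edge is missing from this
        subset, so it is strictly smaller than \<open>J\<close>.\<close>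
      moreover have "finite (parabolic {j \<in> J. m i j = 2})"
        using ij \<open>m i j \<noteq> 2\<close> psubset.prems by (intro psubset.IH) auto
      ultimately have fin_C: "finite {h \<in> parabolic J. h \<otimes>\<^bsub>W\<^esub> cls [i] = cls [i] \<otimes>\<^bsub>W\<^esub> h}"
        by (rule finite_subset)
      have "finite (N \<inter> parabolic J)"
        by (rule C.finite_normal_abelian_inter[OF N(1) _ fin_C]) (rule comm)
      thus ?thesis
        by (rule W.finite_if_finite_inter_finite_index[OF C.H normal_imp_subgroup[OF N(1)] _ N(3)])
    qed
  qed
qed

section \<open>Reduced words and finiteness of the annex\<close>

lemma cox_reduced_appendD:
  assumes "cox_reduced I m (xs @ ys)"
  shows "cox_reduced I m xs" "cox_reduced I m ys"
proof -
  have I: "set xs \<subseteq> I" "set ys \<subseteq> I"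
    and min: "\<And>zs. cox_eq I m (xs @ ys) zs \<Longrightarrow> length (xs @ ys) \<le> length zs"
    using assms by (auto simp: cox_reduced_def)
  have "length xs \<le> length zs" if "cox_eq I m xs zs" for zs
    using min[of "zs @ ys"] cox_eq_context[OF that, of "[]" ys] I by simp
  thus "cox_reduced I m xs" using I by (simp add: cox_reduced_def)
  have "length ys \<le> length zs" if "cox_eq I m ys zs" for zs
    using min[of "xs @ zs"] cox_eq_context[OF that, of xs "[]"] I by simp
  thus "cox_reduced I m ys" using I by (simp add: cox_reduced_def)
qed

lemma obtain_reduced:
  assumes "X \<in> carrier W"
  obtains xs where "xs \<in> X" "cox_reduced I m xs" "X = cls xs"
proof -
  obtain zs where zs: "set zs \<subseteq> I" "X = cls zs"
    using assms by (auto simp: carrier_W)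
  hence "zs \<in> X"
    by (auto simp: cox_cls_def intro: cox_eq.refl)
  then obtain xs where xs: "xs \<in> X" "\<And>ys. ys \<in> X \<Longrightarrow> length xs \<le> length ys"
    using ex_has_least_nat[of "\<lambda>ys. ys \<in> X" zs length] by blast
  have "X = cls xs" "set xs \<subseteq> I"
    using cls_eq_of_mem[of xs zs] xs zs by auto
  moreover from this have "cox_reduced I m xs"
    using xs(2) by (auto simp: cox_reduced_def cox_cls_def)
  ultimately show ?thesis using that xs by blast
qed

text \<open>The length of a reduced word is the minimal length in its class, hence a function of the
  group element.\<close>

lemma finite_length_reduced:
  assumes "finite (parabolic J)"
  shows "finite (length ` {xs. set xs \<subseteq> J \<and> cox_reduced I m xs})"
proof -
  let ?L = "\<lambda>X. LEAST n. \<exists>ys\<in>X. length ys = n"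
  have "length xs = ?L (cls xs)" if "cox_reduced I m xs" for xs
    using that by (intro Least_equality[symmetric])
      (auto simp: cox_reduced_def cox_cls_def intro!: bexI[of _ xs] cox_eq.refl)
  hence "length ` {xs. set xs \<subseteq> J \<and> cox_reduced I m xs} \<subseteq> ?L ` parabolic J"
    by (auto simp: parabolic_def)
  thus ?thesis
    using assms finite_subset by blast
qed

text \<open>Cut \<open>v\<close> into blocks of length \<open>M\<close>. Each is a factor of a
  reduced word, hence reduced, hence contains every generator; the successive letters of
  \<open>u\<close> are picked from successive blocks.\<close>

lemma subseq_of_long_reduced:
  assumes long: "\<And>v. cox_reduced I m v \<Longrightarrow> M \<le> length v \<Longrightarrow> I \<subseteq> set v"
    and "set u \<subseteq> I" "cox_reduced I m v" "M * length u \<le> length v"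
  shows "subseq u v"
  using assms(2-4)
proof (induction u arbitrary: v)
  case (Cons x u)
  have red: "cox_reduced I m (take M v)" "cox_reduced I m (drop M v)"
    using cox_reduced_appendD[of "take M v" "drop M v"] Cons.prems by simp_all
  have "I \<subseteq> set (take M v)"
    using Cons.prems by (intro long red) auto
  hence "subseq [x] (take M v)"
    using Cons.prems by (auto simp: subseq_singleton_left)
  moreover have "subseq u (drop M v)"
    using Cons.prems red by (intro Cons.IH) auto
  ultimately have "subseq ([x] @ u) (take M v @ drop M v)"
    by (rule list_emb_append_mono)
  thus ?case by simp
qed simp

lemma finite_annex:
  assumes fin: "finite I" and par: "\<And>i. i \<in> I \<Longrightarrow> finite (parabolic (I - {i}))"
    and w: "w \<in> carrier W"
  shows "finite (annex I m w)"
proof -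
  have "finite (\<Union>i\<in>I. length ` {xs. set xs \<subseteq> I - {i} \<and> cox_reduced I m xs})"
    using fin par finite_length_reduced by blast
  \<comment> \<open>\<open>M\<close> exceeds the length of every reduced word that omits some
    generator.\<close>
  then obtain M where M: "\<And>k. k \<in> (\<Union>i\<in>I. length ` {xs. set xs \<subseteq> I - {i} \<and> cox_reduced I m xs}) \<Longrightarrow> k < M"
    unfolding finite_nat_set_iff_bounded by blast
  have long: "I \<subseteq> set v" if "cox_reduced I m v" "M \<le> length v" for v
  proof
    fix i assume "i \<in> I"
    show "i \<in> set v"
    proof (rule ccontr)
      assume "i \<notin> set v"
      hence "length v < M"
        using that(1) \<open>i \<in> I\<close> by (intro M) (auto simp: cox_reduced_def)
      thus False using that by simp
    qed
  qed
  obtain u where u: "u \<in> w" "cox_reduced I m u"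
    using obtain_reduced[OF w] by blast
  have "annex I m w \<subseteq> cls ` {v. set v \<subseteq> I \<and> length v \<le> M * length u}"
  proof
    fix y assume y: "y \<in> annex I m w"
    obtain v where v: "v \<in> y" "cox_reduced I m v" "y = cls v"
      using obtain_reduced[of y] y by (auto simp: annex_def)
    have "\<not> subseq u v"
      using y u v by (auto simp: annex_def bruhat_le_def)
    \<comment> \<open>So each element of the annex has a reduced word of bounded length over the
      finite alphabet \<open>I\<close>.\<close>
    hence "\<not> M * length u \<le> length v"
      using subseq_of_long_reduced[OF long _ v(2)] u by (auto simp: cox_reduced_def)
    thus "y \<in> cls ` {v. set v \<subseteq> I \<and> length v \<le> M * length u}"
      using v by (auto simp: cox_reduced_def)
  qed
  thus ?thesis
    by (rule finite_subset) (intro finite_imageI finite_lists_length_le fin)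
qed

end

theorem theorem1p2:
  fixes I :: "'i set" and m :: "'i \<Rightarrow> 'i \<Rightarrow> enat" and w :: "'i list set"
  assumes "finite I"
    and "coxeter_matrix I m"
    and "cox_irreducible I m"
    and "affine_coxeter I m"
    and "w \<in> carrier (coxW I m)"
  shows "finite (annex I m w)"
proof -
  interpret coxeter_presentation I m
    by unfold_locales (rule assms)
  show ?thesis
    using assms by (intro finite_annex finite_proper_parabolic) auto
qed

end
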